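(* Let $1\le k\le d\le n-1$ and let $(M,\{W_j\},\{S_i^j\})$ be an exact-repair regenerating code of type $(n,k,d)$ with parameters $(B,\alpha,\beta)$. Let $q,\ell,m$ be positive integers with $q+\ell+m\le k$. Let $N\ge 3$ be an integer and let $V_1,V_2,\ldots,V_{N-2}$ be subsets of $\{\ell+m+1,\ldots,d+1\}$ with sizes $q_i=|V_i|\le k-\ell-m$ and with empty intersection $V_1\cap V_2\cap\cdots\cap V_{N-2}=\emptyset$. Then \[ N\,B\;\le\; B_q+\sum_{i=1}^{N-2}B_{q_i}+B_{\ell+m}-\ell m\,\beta . \]
   Context: Fix integers $1\le k\le d\le n-1$. An exact-repair regenerating code of type $(n,k,d)$ with parameters $(B,\alpha,\beta)$ (nonnegative reals) is a collection of jointly distributed discrete random variables $M$, $W_j$ ($1\le j\le n$), $S_i^j$ ($1\le i,j\le n$, $i\neq j$) such that, with $H$ denoting Shannon entropy: $H(M)=B$; $H(W_j)=\alpha$ and $H(W_j\mid M)=0$ for all $j$; $H(M\mid W_J)=0$ for every $J\subseteq\{1,\dots,n\}$ with $|J|\ge k$; $H(S_i^j)=\beta$ and $H(S_i^j\mid W_i)=0$ for all $i\ne j$; and $H(W_j\mid S_I^j)=0$ for every $I\subseteq\{1,\dots,n\}\setminus\{j\}$ with $|I|\ge d$. Notation: for a set $J$, $W_J=(W_j)_{j\in J}$; for sets $I,J$, $S_I^J=(S_i^j)_{i\in I,\,j\in J,\,i\neq j}$ and $S_I^j=S_I^{\{j\}}$. For $0\le q\le k$, define $B_q=q\alpha+\binom{k-q}{2}\beta+(d+1-k)(k-q)\beta$.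 *)

theory Defs
  imports "HOL-Probability.Probability"
begin

(* Shannon entropy (base 2) of a discrete distribution, valued in [0, \<infinity>];
   convention 0 log 0 = 0 holds since log 2 0 = 0 in Isabelle. *)
definition pmf_entropy :: "'a pmf \<Rightarrow> ennreal" where
  "pmf_entropy P = (\<integral>\<^sup>+ x. ennreal (- pmf P x * log 2 (pmf P x)) \<partial>count_space UNIV)"

definition ent :: "'w pmf \<Rightarrow> ('w \<Rightarrow> 'a) \<Rightarrow> ennreal" where
  "ent p X = pmf_entropy (map_pmf X p)"

definition cent :: "'w pmf \<Rightarrow> ('w \<Rightarrow> 'a) \<Rightarrow> ('w \<Rightarrow> 'b) \<Rightarrow> ennreal" where
  "cent p X Y = (\<integral>\<^sup>+ y. ennreal (pmf (map_pmf Y p) y) *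
       pmf_entropy (map_pmf X (cond_pmf p {\<omega>. Y \<omega> = y})) \<partial>count_space UNIV)"

definition Wset :: "(nat \<Rightarrow> 'w \<Rightarrow> 'a) \<Rightarrow> nat set \<Rightarrow> 'w \<Rightarrow> (nat \<Rightarrow> 'a)" where
  "Wset W J = (\<lambda>\<omega>. restrict (\<lambda>j. W j \<omega>) J)"

definition Sset :: "(nat \<Rightarrow> nat \<Rightarrow> 'w \<Rightarrow> 'b) \<Rightarrow> nat set \<Rightarrow> nat set \<Rightarrow> 'w \<Rightarrow> (nat \<times> nat \<Rightarrow> 'b)" where
  "Sset S I J = (\<lambda>\<omega>. \<lambda>(i, j). if i \<in> I \<and> j \<in> J \<and> i \<noteq> j then S i j \<omega> else undefined)"

definition exact_repair_code ::
  "'w pmf \<Rightarrow> nat \<Rightarrow> nat \<Rightarrow> nat \<Rightarrow> real \<Rightarrow> real \<Rightarrow> real \<Rightarrow>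
   ('w \<Rightarrow> 'm) \<Rightarrow> (nat \<Rightarrow> 'w \<Rightarrow> 'a) \<Rightarrow> (nat \<Rightarrow> nat \<Rightarrow> 'w \<Rightarrow> 'b) \<Rightarrow> bool" where
  "exact_repair_code p n k d B \<alpha> \<beta> M W S \<longleftrightarrow>
     B \<ge> 0 \<and> \<alpha> \<ge> 0 \<and> \<beta> \<ge> 0 \<and>
     ent p M = ennreal B \<and>
     (\<forall>j\<in>{1..n}. ent p (W j) = ennreal \<alpha> \<and> cent p (W j) M = 0) \<and>
     (\<forall>J. J \<subseteq> {1..n} \<and> card J \<ge> k \<longrightarrow> cent p M (Wset W J) = 0) \<and>
     (\<forall>i\<in>{1..n}. \<forall>j\<in>{1..n}. i \<noteq> j \<longrightarrow>
         ent p (S i j) = ennreal \<beta> \<and> cent p (S i j) (W i) = 0) \<and>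
     (\<forall>j\<in>{1..n}. \<forall>I. I \<subseteq> {1..n} - {j} \<and> card I \<ge> d \<longrightarrow>
         cent p (W j) (Sset S I {j}) = 0)"

definition Bq :: "nat \<Rightarrow> nat \<Rightarrow> real \<Rightarrow> real \<Rightarrow> nat \<Rightarrow> real" where
  "Bq k d \<alpha> \<beta> q = real q * \<alpha> + real ((k - q) choose 2) * \<beta> + real (d + 1 - k) * real (k - q) * \<beta>"

end

theory Submission
  imports Defs
begin

text \<open>
  Let \<open>C = L \<union> P\<close> with \<open>|L| = l\<close>, \<open>|P| = m\<close> be the first \<open>l + m\<close> nodes, \<open>T = {l+m+1..d+1}\<close>, and let
  \<open>Z\<close> be the data sent from \<open>T\<close> to \<open>C\<close>. For each \<open>i\<close>, the file is recovered from the nodes in \<open>V\<^sub>i\<close>,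
  then \<open>Z\<close>, then the data exchanged inside \<open>C\<close>, then the repair of further nodes. The slack in
  bounding the part of \<open>Z\<close> sent by \<open>J\<close> by \<open>|J| (l + m) \<beta>\<close> is a supermodular function of \<open>J\<close>, and since
  the \<open>V\<^sub>i\<close> have empty intersection the sum over \<open>i\<close> collects the full slack of \<open>Z\<close>; this replaces
  \<open>(l + m) |T| \<beta>\<close> by \<open>H(Z)\<close> once. It then remains to bound \<open>H(Z, W\<^sub>C) + H(W\<^sub>C)\<close>, which by
  submodularity is at most \<open>H(W\<^sub>C, S\<^sub>T\<^sup>P) + H(W\<^sub>C, S\<^sub>T\<^sup>L)\<close>: the first term is generated by \<open>W\<^sub>L\<close>, the data
  \<open>T \<rightarrow> P\<close> and the data inside \<open>P\<close>, the second one symmetrically, so the \<open>l m\<close> messages between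
  \<open>L\<close> and \<open>P\<close> are never paid for.
\<close>

section \<open>Entropy as an expectation\<close>

definition surprisal :: "'w pmf \<Rightarrow> ('w \<Rightarrow> 'a) \<Rightarrow> 'w \<Rightarrow> real" where
  "surprisal p X \<omega> = - log 2 (pmf (map_pmf X p) (X \<omega>))"

text \<open>The Bochner expectation is 0 for non-integrable functions, so comparisons of
  \<open>shannon\<close> values carry an integrability hypothesis.\<close>

definition shannon :: "'w pmf \<Rightarrow> ('w \<Rightarrow> 'a) \<Rightarrow> real" where
  "shannon p X = measure_pmf.expectation p (surprisal p X)"

text \<open>Functional dependence on the support of \<open>p\<close>, the form in which vanishing
  conditional entropy is used throughout.\<close>

definition determines :: "'w pmf \<Rightarrow> ('w \<Rightarrow> 'a) \<Rightarrow> ('w \<Rightarrow> 'b) \<Rightarrow> bool" where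
  "determines p Y X \<longleftrightarrow> (\<forall>\<omega>\<in>set_pmf p. \<forall>\<omega>'\<in>set_pmf p. Y \<omega> = Y \<omega>' \<longrightarrow> X \<omega> = X \<omega>')"

lemma pmf_map_pos: "\<omega> \<in> set_pmf p \<Longrightarrow> pmf (map_pmf X p) (X \<omega>) > 0"
  by (rule pmf_positive) auto

lemma surprisal_nonneg: "\<omega> \<in> set_pmf p \<Longrightarrow> surprisal p X \<omega> \<ge> 0"
  using pmf_map_pos[of \<omega> p X] pmf_le_1[of "map_pmf X p" "X \<omega>"]
  by (simp add: surprisal_def)

lemma ent_eq_nn_integral_surprisal:
  "ent p X = (\<integral>\<^sup>+ \<omega>. ennreal (surprisal p X \<omega>) \<partial>measure_pmf p)"
proof -
  let ?P = "map_pmf X p"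
  have "ent p X = (\<integral>\<^sup>+ x. ennreal (pmf ?P x) * ennreal (- log 2 (pmf ?P x)) \<partial>count_space UNIV)"
    unfolding ent_def pmf_entropy_def
    by (intro nn_integral_cong) (simp add: ennreal_mult'[symmetric])
  also have "\<dots> = (\<integral>\<^sup>+ x. ennreal (- log 2 (pmf ?P x)) \<partial>measure_pmf ?P)"
    by (simp add: nn_integral_measure_pmf)
  also have "\<dots> = (\<integral>\<^sup>+ \<omega>. ennreal (surprisal p X \<omega>) \<partial>measure_pmf p)"
    by (simp add: surprisal_def)
  finally show ?thesis .
qed

lemma ent_finite_imp:
  assumes "ent p X = ennreal b" "b \<ge> 0"
  shows integrable_surprisal_of_ent: "integrable (measure_pmf p) (surprisal p X)"
    and shannon_of_ent: "shannon p X = b"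
proof -
  have nn: "AE \<omega> in measure_pmf p. 0 \<le> surprisal p X \<omega>"
    by (auto simp: AE_measure_pmf_iff surprisal_nonneg)
  have eq: "(\<integral>\<^sup>+ \<omega>. ennreal (surprisal p X \<omega>) \<partial>measure_pmf p) = ennreal b"
    using assms(1) by (simp add: ent_eq_nn_integral_surprisal)
  show int: "integrable (measure_pmf p) (surprisal p X)"
    by (rule integrableI_nonneg) (use nn eq in auto)
  show "shannon p X = b"
    unfolding shannon_def by (rule integral_eq_nn_integral[THEN trans])
      (use nn eq assms(2) in auto)
qed

text \<open>Within the support, the fibre of \<open>Y\<close> through a point lies in the fibre of
  \<open>X\<close>, so it has at most the same probability.\<close>

lemma surprisal_mono:
  assumes "determines p Y X" "\<omega> \<in> set_pmf p"
  shows "surprisal p X \<omega> \<le> surprisal p Y \<omega>"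
proof -
  have "pmf (map_pmf Y p) (Y \<omega>) = measure (measure_pmf p) (Y -` {Y \<omega>} \<inter> set_pmf p)"
    unfolding pmf_map by (rule measure_Int_set_pmf[symmetric])
  also have "\<dots> \<le> measure (measure_pmf p) (X -` {X \<omega>})"
  proof (rule measure_pmf.finite_measure_mono)
    show "Y -` {Y \<omega>} \<inter> set_pmf p \<subseteq> X -` {X \<omega>}"
      using assms unfolding determines_def by blast
  qed simp
  finally show ?thesis
    using pmf_map_pos[OF assms(2), of Y] unfolding surprisal_def pmf_map by simp
qed

lemma integrable_surprisal_determined:
  assumes "determines p Y X" "integrable (measure_pmf p) (surprisal p Y)"
  shows "integrable (measure_pmf p) (surprisal p X)"
proof (rule Bochner_Integration.integrable_bound[OF assms(2)])
  show "AE \<omega> in measure_pmf p. norm (surprisal p X \<omega>) \<le> norm (surprisal p Y \<omega>)"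
    unfolding AE_measure_pmf_iff
  proof
    fix \<omega> assume "\<omega> \<in> set_pmf p"
    then show "norm (surprisal p X \<omega>) \<le> norm (surprisal p Y \<omega>)"
      using surprisal_mono[OF assms(1)] surprisal_nonneg[of \<omega> p X] by fastforce
  qed
qed simp

lemma shannon_mono:
  assumes "determines p Y X" "integrable (measure_pmf p) (surprisal p Y)"
  shows "shannon p X \<le> shannon p Y"
  unfolding shannon_def
  by (rule integral_mono_AE[OF integrable_surprisal_determined[OF assms] assms(2)])
     (simp add: AE_measure_pmf_iff surprisal_mono[OF assms(1)])

lemma shannon_const: "shannon p (\<lambda>_. c) = 0"
  by (simp add: shannon_def surprisal_def[abs_def] map_pmf_const)

section \<open>Zero conditional entropy as functional dependence\<close>

text \<open>All summands are nonnegative, hence zero, so an atom of positive mass must have mass 1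
  and leaves no room for a second one.\<close>

lemma pmf_entropy_0_imp:
  assumes "pmf_entropy P = 0" "x \<in> set_pmf P" "y \<in> set_pmf P"
  shows "x = y"
proof (rule ccontr)
  assume "x \<noteq> y"
  have "AE z in count_space UNIV. ennreal (- pmf P z * log 2 (pmf P z)) = 0"
    using assms(1) unfolding pmf_entropy_def by (subst (asm) nn_integral_0_iff_AE) auto
  then have "- pmf P x * log 2 (pmf P x) \<le> 0"
    by (auto simp: AE_count_space ennreal_eq_0_iff)
  moreover have pos: "pmf P x > 0" "pmf P y > 0"
    using assms by (auto simp: pmf_positive)
  ultimately have "log 2 (pmf P x) \<ge> 0"
    by (simp add: zero_le_mult_iff)
  then have "pmf P x \<ge> 1"
    using pos by simp
  moreover have "pmf P x + pmf P y = measure (measure_pmf P) {x, y}"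
    using \<open>x \<noteq> y\<close> by (simp add: measure_measure_pmf_finite)
  ultimately show False
    using pos measure_pmf.prob_le_1[of P "{x, y}"] by linarith
qed

text \<open>A value of \<open>Y\<close> attained on the support has positive weight in
  \<open>cent\<close>, so the conditional law of \<open>X\<close> given that value is a point
  mass.\<close>

lemma cent_0_imp_determines:
  assumes "cent p X Y = 0"
  shows "determines p Y X"
  unfolding determines_def
proof (intro ballI impI)
  fix \<omega> \<omega>' assume \<omega>: "\<omega> \<in> set_pmf p" "\<omega>' \<in> set_pmf p" "Y \<omega> = Y \<omega>'"
  let ?C = "{\<omega>'. Y \<omega>' = Y \<omega>}"
  have "ennreal (pmf (map_pmf Y p) (Y \<omega>)) * pmf_entropy (map_pmf X (cond_pmf p ?C)) = 0"
    using assms unfolding cent_def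
    by (subst (asm) nn_integral_0_iff_AE) (auto simp: AE_count_space)
  then have "pmf_entropy (map_pmf X (cond_pmf p ?C)) = 0"
    using pmf_map_pos[OF \<omega>(1), of Y] by (auto simp: ennreal_eq_0_iff)
  moreover have "set_pmf (cond_pmf p ?C) = set_pmf p \<inter> ?C"
    by (rule set_cond_pmf) (use \<omega> in auto)
  then have "X \<omega> \<in> set_pmf (map_pmf X (cond_pmf p ?C))" "X \<omega>' \<in> set_pmf (map_pmf X (cond_pmf p ?C))"
    using \<omega> by auto
  ultimately show "X \<omega> = X \<omega>'"
    by (rule pmf_entropy_0_imp)
qed

section \<open>Submodularity of Shannon entropy\<close>

lemma nn_integral_pmf_fst:
  "(\<integral>\<^sup>+ y. ennreal (pmf (map_pmf (\<lambda>\<omega>. (Y \<omega>, Z \<omega>)) p) (y, z)) \<partial>count_space UNIV)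
     = ennreal (pmf (map_pmf Z p) z)"
proof -
  let ?P = "map_pmf (\<lambda>\<omega>. (Y \<omega>, Z \<omega>)) p"
  have "(\<integral>\<^sup>+ y. ennreal (pmf ?P (y, z)) \<partial>count_space UNIV)
      = emeasure (measure_pmf ?P) (range (\<lambda>y. (y, z)))"
    by (rule nn_integral_pmf') (auto simp: inj_on_def)
  also have "\<dots> = emeasure (measure_pmf p) (Z -` {z})"
    by (auto intro!: arg_cong2[where f = emeasure])
  also have "\<dots> = ennreal (pmf (map_pmf Z p) z)"
    by (simp add: pmf_map measure_pmf.emeasure_eq_measure)
  finally show ?thesis .
qed

text \<open>Bounding the logarithm of the density ratio by the ratio minus one reduces submodularity to
  the fact that the conditionally independent coupling has total mass at most one.\<close>

lemma shannon_submodular: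
  fixes p :: "'w pmf" and X :: "'w \<Rightarrow> 'a" and Y :: "'w \<Rightarrow> 'b" and Z :: "'w \<Rightarrow> 'c"
  assumes int: "integrable (measure_pmf p) (surprisal p (\<lambda>\<omega>. (X \<omega>, Y \<omega>, Z \<omega>)))"
  shows "shannon p (\<lambda>\<omega>. (X \<omega>, Y \<omega>, Z \<omega>)) + shannon p Z
       \<le> shannon p (\<lambda>\<omega>. (X \<omega>, Z \<omega>)) + shannon p (\<lambda>\<omega>. (Y \<omega>, Z \<omega>))"
proof -
  define XYZ where "XYZ = (\<lambda>\<omega>. (X \<omega>, Y \<omega>, Z \<omega>))"
  define XZ where "XZ = (\<lambda>\<omega>. (X \<omega>, Z \<omega>))"
  define YZ where "YZ = (\<lambda>\<omega>. (Y \<omega>, Z \<omega>))"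
  let ?a = "pmf (map_pmf XYZ p)" and ?b = "pmf (map_pmf XZ p)"
    and ?c = "pmf (map_pmf YZ p)" and ?e = "pmf (map_pmf Z p)"
  \<comment> \<open>\<open>r\<close> is the law making \<open>X\<close> and \<open>Y\<close>
    conditionally independent given \<open>Z\<close> with the same pair marginals; \<open>R\<close>
    is its density relative to the true joint law.\<close>
  define r where "r = (\<lambda>(x, y, z). ?b (x, z) * ?c (y, z) / ?e z)"
  define R where "R = (\<lambda>\<omega>. r (XYZ \<omega>) / ?a (XYZ \<omega>))"
  have int': "integrable (measure_pmf p) (surprisal p XYZ)"
    using int by (simp add: XYZ_def)
  have ints: "integrable (measure_pmf p) (surprisal p XZ)" "integrable (measure_pmf p) (surprisal p YZ)"
    "integrable (measure_pmf p) (surprisal p Z)"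
    by (rule integrable_surprisal_determined[OF _ int'],
        simp add: determines_def XYZ_def XZ_def YZ_def)+
  have r0: "r v \<ge> 0" for v
    by (auto simp: r_def split: prod.split)
  have R0: "R \<omega> \<ge> 0" for \<omega>
    by (simp add: R_def r0)
  have "(\<integral>\<^sup>+ \<omega>. ennreal (R \<omega>) \<partial>measure_pmf p)
      = (\<integral>\<^sup>+ v. ennreal (r v / ?a v) \<partial>measure_pmf (map_pmf XYZ p))"
    by (simp add: R_def)
  also have "\<dots> = (\<integral>\<^sup>+ v. ennreal (?a v) * ennreal (r v / ?a v) \<partial>count_space UNIV)"
    by (rule nn_integral_measure_pmf)
  \<comment> \<open>Equality can fail only at points of joint mass 0, where division by zero makes
    the left side vanish.\<close>
  also have "\<dots> \<le> (\<integral>\<^sup>+ v. ennreal (r v) \<partial>count_space UNIV)"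
    by (intro nn_integral_mono) (auto simp: ennreal_mult'[symmetric] r0)
  also have "\<dots> = (\<integral>\<^sup>+ x. \<integral>\<^sup>+ w. ennreal (r (x, w)) \<partial>count_space UNIV \<partial>count_space UNIV)"
    by (rule nn_integral_fst_count_space[symmetric])
  also have "\<dots> = (\<integral>\<^sup>+ x. \<integral>\<^sup>+ z. \<integral>\<^sup>+ y. ennreal (r (x, y, z)) \<partial>count_space UNIV \<partial>count_space UNIV \<partial>count_space UNIV)"
    by (subst nn_integral_snd_count_space) simp
  also have "\<dots> \<le> (\<integral>\<^sup>+ x. \<integral>\<^sup>+ z. ennreal (?b (x, z)) \<partial>count_space UNIV \<partial>count_space UNIV)"
  proof (intro nn_integral_mono)
    fix x z
    have "(\<integral>\<^sup>+ y. ennreal (r (x, y, z)) \<partial>count_space UNIV)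
        = (\<integral>\<^sup>+ y. ennreal (?b (x, z) / ?e z) * ennreal (?c (y, z)) \<partial>count_space UNIV)"
      by (intro nn_integral_cong) (simp add: r_def ennreal_mult'[symmetric])
    also have "\<dots> = ennreal (?b (x, z) / ?e z) * ennreal (?e z)"
      by (simp add: nn_integral_cmult YZ_def nn_integral_pmf_fst)
    also have "\<dots> \<le> ennreal (?b (x, z))"
      by (simp add: ennreal_mult'[symmetric])
    finally show "(\<integral>\<^sup>+ y. ennreal (r (x, y, z)) \<partial>count_space UNIV) \<le> ennreal (?b (x, z))" .
  qed
  also have "\<dots> = (\<integral>\<^sup>+ v. ennreal (?b v) \<partial>count_space UNIV)"
    by (rule nn_integral_fst_count_space)
  also have "\<dots> = 1"
    by (simp add: nn_integral_pmf)
  finally have R1: "(\<integral>\<^sup>+ \<omega>. ennreal (R \<omega>) \<partial>measure_pmf p) \<le> 1" .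
  have intR: "integrable (measure_pmf p) R"
    by (rule integrableI_nonneg) (use R0 le_less_trans[OF R1] in auto)
  have ER: "measure_pmf.expectation p R \<le> 1"
  proof -
    have "ennreal (measure_pmf.expectation p R) \<le> 1"
      using R1 nn_integral_eq_integral[OF intR] R0 by simp
    then show ?thesis by (simp add: ennreal_le_1)
  qed
  have pt: "surprisal p XYZ \<omega> + surprisal p Z \<omega> - surprisal p XZ \<omega> - surprisal p YZ \<omega> \<le> (R \<omega> - 1) / ln 2"
    if "\<omega> \<in> set_pmf p" for \<omega>
  proof -
    note pos = pmf_map_pos[OF that, of XYZ] pmf_map_pos[OF that, of XZ]
      pmf_map_pos[OF that, of YZ] pmf_map_pos[OF that, of Z]
    have R: "R \<omega> = ?b (XZ \<omega>) * ?c (YZ \<omega>) / ?e (Z \<omega>) / ?a (XYZ \<omega>)"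
      by (simp add: R_def r_def XYZ_def XZ_def YZ_def)
    have "surprisal p XYZ \<omega> + surprisal p Z \<omega> - surprisal p XZ \<omega> - surprisal p YZ \<omega> = log 2 (R \<omega>)"
      using pos unfolding R surprisal_def by (simp add: log_mult log_divide)
    also have "\<dots> \<le> (R \<omega> - 1) / ln 2"
      using pos by (auto simp: log_def R intro!: divide_right_mono ln_le_minus_one)
    finally show ?thesis .
  qed
  have "measure_pmf.expectation p
      (\<lambda>\<omega>. surprisal p XYZ \<omega> + surprisal p Z \<omega> - surprisal p XZ \<omega> - surprisal p YZ \<omega>)
     \<le> measure_pmf.expectation p (\<lambda>\<omega>. (R \<omega> - 1) / ln 2)"
    by (intro integral_mono_AE) (auto simp: AE_measure_pmf_iff pt int' ints intR)
  also have "\<dots> = (measure_pmf.expectation p R - 1) / ln 2"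
    using intR by simp
  also have "\<dots> \<le> 0"
    using ER by (simp add: divide_le_0_iff)
  finally show ?thesis
    using int' ints by (simp add: shannon_def XYZ_def XZ_def YZ_def)
qed

section \<open>Polymatroids with repair structure\<close>

lemma choose_two_add: "(a + b) choose 2 = (a choose 2) + (b choose 2) + a * b"
proof (induction a)
  case (Suc a)
  have "Suc x choose 2 = (x choose 2) + x" for x
    by (simp add: numeral_2_eq_2)
  then show ?case using Suc by simp
qed simp

section \<open>Monotone submodular set functions\<close>

locale polymatroid =
  fixes H :: "'v set \<Rightarrow> real"
  assumes mono: "A \<subseteq> C \<Longrightarrow> H A \<le> H C"
    and submodular: "H (A \<union> C) + H (A \<inter> C) \<le> H A + H C"
    and empty: "H {} = 0"
begin

lemma union_le: "H (A \<union> C) \<le> H A + H C"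
  using submodular[of A C] mono[of "{}" "A \<inter> C"] empty by simp

lemma submodular_le:
  assumes "X \<subseteq> A \<union> C" "Y \<subseteq> A" "Y \<subseteq> C"
  shows "H X + H Y \<le> H A + H C"
  using submodular[of A C] mono[OF assms(1)] mono[of Y "A \<inter> C"] assms by simp

lemma union_le_sum:
  assumes "finite C" "\<And>v. v \<in> C \<Longrightarrow> H {v} \<le> c"
  shows "H (A \<union> C) \<le> H A + real (card C) * c"
  using assms
proof (induction C rule: finite_induct)
  case (insert v C)
  have "H (A \<union> insert v C) \<le> H (A \<union> C) + H {v}"
    using union_le[of "A \<union> C" "{v}"] by simp
  moreover have "H (A \<union> C) \<le> H A + real (card C) * c" "H {v} \<le> c"
    using insert by auto
  ultimately show ?case
    using insert.hyps by (simp add: algebra_simps)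
qed simp

text \<open>By submodularity, an element that adds nothing to \<open>A\<close> adds nothing to any
  larger set either, so elements can be added one at a time.\<close>

lemma union_eq_of_determined:
  assumes "finite C" "\<And>v. v \<in> C \<Longrightarrow> H (insert v A) \<le> H A"
  shows "H (A \<union> C) = H A"
  using assms
proof (induction C rule: finite_induct)
  case (insert v C)
  have "H (A \<union> insert v C) + H A \<le> H (A \<union> C) + H (insert v A)"
    by (rule submodular_le) auto
  then have "H (A \<union> insert v C) \<le> H A"
    using insert by (smt (verit) insertCI)
  then show ?case
    using mono[of A "A \<union> insert v C"] by (intro antisym) auto
qed simp

end

text \<open>Each new set is merged with the running intersection, at the price of one
  \<open>g T\<close>. The index \<open>Suc r\<close> keeps the family nonempty, so that its
  intersection stays inside \<open>T\<close>.\<close>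

lemma supermodular_Inter_bound:
  fixes g :: "'t set \<Rightarrow> real" and V :: "nat \<Rightarrow> 't set"
  assumes super: "\<And>A C. A \<subseteq> T \<Longrightarrow> C \<subseteq> T \<Longrightarrow> g A + g C \<le> g (A \<union> C) + g (A \<inter> C)"
    and mono: "\<And>A. A \<subseteq> T \<Longrightarrow> g A \<le> g T"
    and V: "\<And>i. i \<in> {1..Suc r} \<Longrightarrow> V i \<subseteq> T"
  shows "(\<Sum>i=1..Suc r. g (V i)) \<le> real r * g T + g (\<Inter>i\<in>{1..Suc r}. V i)"
  using V
proof (induction r)
  case (Suc r)
  let ?I = "\<Inter>i\<in>{1..Suc r}. V i"
  have "?I \<subseteq> V 1" by auto
  then have sub: "?I \<subseteq> T" "V (Suc (Suc r)) \<subseteq> T"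
    using Suc.prems[of 1] Suc.prems[of "Suc (Suc r)"] by auto
  have Int: "(\<Inter>i\<in>{1..Suc (Suc r)}. V i) = ?I \<inter> V (Suc (Suc r))"
    by (auto simp: atLeastAtMostSuc_conv)
  have "g ?I + g (V (Suc (Suc r))) \<le> g T + g (?I \<inter> V (Suc (Suc r)))"
    using super[OF sub] mono[of "?I \<union> V (Suc (Suc r))"] sub by simp
  moreover have "(\<Sum>i=1..Suc r. g (V i)) \<le> real r * g T + g ?I"
    using Suc by simp
  ultimately show ?case
    unfolding Int by (simp add: algebra_simps)
qed simp

section \<open>Stored data, repair messages and their entropy costs\<close>

definition node_vars :: "nat set \<Rightarrow> (nat + nat \<times> nat) set" where
  "node_vars J = Inl ` J"

definition helper_vars :: "nat set \<Rightarrow> nat set \<Rightarrow> (nat + nat \<times> nat) set" where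
  "helper_vars I J = Inr ` (I \<times> J)"

lemma node_vars_Un: "node_vars (I \<union> J) = node_vars I \<union> node_vars J"
  by (auto simp: node_vars_def)

lemma card_node_vars: "card (node_vars J) = card J"
  by (simp add: node_vars_def card_image)

lemma card_helper_vars: "card (helper_vars I J) = card I * card J"
  by (simp add: helper_vars_def card_image card_cartesian_product)

lemma finite_node_vars: "finite J \<Longrightarrow> finite (node_vars J)"
  by (simp add: node_vars_def)

lemma finite_helper_vars: "finite I \<Longrightarrow> finite J \<Longrightarrow> finite (helper_vars I J)"
  by (simp add: helper_vars_def)

text \<open>Only the first \<open>d + 1\<close> nodes take part in repair and recovery, so the
  helpers of a node are exactly the other \<open>d\<close>. The file enters only through the lower
  bound \<open>B\<close> on sets that contain \<open>k\<close> nodes.\<close>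

locale repair_polymatroid = polymatroid H
  for H :: "(nat + nat \<times> nat) set \<Rightarrow> real" +
  fixes k d :: nat and B \<alpha> \<beta> :: real
  assumes k_le_d: "k \<le> d"
    and node_le: "H {Inl j} \<le> \<alpha>"
    and helper_le: "H {Inr (i, j)} \<le> \<beta>"
    and node_determines_helper: "Inl i \<in> A \<Longrightarrow> H (insert (Inr (i, j)) A) \<le> H A"
    and helpers_determine_node:
      "j \<in> {1..d+1} \<Longrightarrow> helper_vars ({1..d+1} - {j}) {j} \<subseteq> A \<Longrightarrow> H (insert (Inl j) A) \<le> H A"
    and recovery: "J \<subseteq> {1..d+1} \<Longrightarrow> card J = k \<Longrightarrow> node_vars J \<subseteq> A \<Longrightarrow> B \<le> H A"
begin

abbreviation "D \<equiv> {1..d+1}"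

lemma add_helpers:
  assumes "finite I" "finite J"
  shows "H (A \<union> helper_vars I J) \<le> H A + real (card I * card J) * \<beta>"
proof -
  have "H (A \<union> helper_vars I J) \<le> H A + real (card (helper_vars I J)) * \<beta>"
    by (rule union_le_sum) (use assms helper_le in \<open>auto simp: finite_helper_vars helper_vars_def\<close>)
  then show ?thesis by (simp add: card_helper_vars)
qed

lemma nodes_le:
  assumes "finite J"
  shows "H (node_vars J) \<le> real (card J) * \<alpha>"
proof -
  have "H ({} \<union> node_vars J) \<le> H {} + real (card (node_vars J)) * \<alpha>"
    by (rule union_le_sum) (use assms node_le in \<open>auto simp: finite_node_vars node_vars_def\<close>)
  then show ?thesis by (simp add: card_node_vars empty)
qed

lemma nodes_determine_helpers:
  assumes "finite I" "finite J" "node_vars I \<subseteq> A"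
  shows "H (A \<union> helper_vars I J) = H A"
  by (rule union_eq_of_determined)
    (use assms in \<open>auto simp: finite_helper_vars helper_vars_def node_vars_def
       intro!: node_determines_helper\<close>)

text \<open>The nodes of \<open>R\<close> are repaired in turn. Each pays only for messages from
  members of \<open>R\<close> still unrepaired: known nodes send for free, and messages from outside
  are already in \<open>A\<close>. The payments add up to \<open>card R choose 2\<close>.\<close>

lemma repair_nodes:
  assumes "finite R" "K \<subseteq> D" "R \<subseteq> D" "K \<inter> R = {}"
    and "node_vars K \<subseteq> A" "helper_vars (D - K - R) R \<subseteq> A"
  shows "H (A \<union> node_vars R) \<le> H A + real (card R choose 2) * \<beta>"
  using assms
proof (induction R arbitrary: A K rule: finite_induct)
  case empty
  then show ?case by (simp add: node_vars_def numeral_2_eq_2)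
next
  case (insert r R)
  let ?A1 = "A \<union> helper_vars R {r}"
  let ?A2 = "?A1 \<union> helper_vars K {r}"
  let ?A3 = "insert (Inl r) ?A2"
  have fK: "finite K"
    using insert.prems(1) finite_subset by blast
  have A1: "H ?A1 \<le> H A + real (card R) * \<beta>"
    using add_helpers[of R "{r}" A] insert.hyps by simp
  have A2: "H ?A2 = H ?A1"
    by (rule nodes_determine_helpers) (use fK insert.prems in auto)
  have A3: "H ?A3 \<le> H ?A2"
  proof (rule helpers_determine_node)
    have "D - {r} \<subseteq> (D - K - insert r R) \<union> R \<union> K"
      by auto
    then have "helper_vars (D - {r}) {r}
        \<subseteq> helper_vars (D - K - insert r R) (insert r R) \<union> helper_vars R {r} \<union> helper_vars K {r}"
      unfolding helper_vars_def by blast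
    then show "helper_vars (D - {r}) {r} \<subseteq> ?A2"
      using insert.prems(5) by blast
  qed (use insert.prems in auto)
  have eq: "D - insert r K - R = D - K - insert r R"
    by auto
  \<comment> \<open>The repaired node \<open>r\<close> joins the known nodes \<open>K\<close> for
    the rest of \<open>R\<close>.\<close>
  have "H (?A3 \<union> node_vars R) \<le> H ?A3 + real (card R choose 2) * \<beta>"
  proof (rule insert.IH)
    show "helper_vars (D - insert r K - R) R \<subseteq> ?A3"
      unfolding eq using insert.prems(5) by (auto simp: helper_vars_def)
  qed (use insert in \<open>auto simp: node_vars_def\<close>)
  moreover have "H (A \<union> node_vars (insert r R)) \<le> H (?A3 \<union> node_vars R)"
    by (rule mono) (auto simp: node_vars_def)
  moreover have "Suc (card R) choose 2 = (card R choose 2) + card R"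
    by (simp add: numeral_2_eq_2)
  ultimately show ?case
    using A1 A2 A3 insert.hyps by (simp add: algebra_simps)
qed

section \<open>Extending a set of nodes until the file is recovered\<close>

definition completion_cost :: "nat \<Rightarrow> real" where
  "completion_cost a = real ((k - a) choose 2) * \<beta> + real (d + 1 - k) * real (k - a) * \<beta>"

lemma Bq_eq: "Bq k d \<alpha> \<beta> a = real a * \<alpha> + completion_cost a"
  by (simp add: Bq_def completion_cost_def)

text \<open>Choose \<open>k - card K\<close> further nodes \<open>R\<close>. The
  \<open>d + 1 - k\<close> remaining nodes send to all of \<open>R\<close>, one
  \<open>\<beta>\<close> per message, and \<open>repair_nodes\<close> covers the messages inside
  \<open>R\<close>.\<close>

lemma completion:
  assumes "K \<subseteq> D" "card K \<le> k" "node_vars K \<subseteq> A"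
  shows "B \<le> H A + completion_cost (card K)"
proof -
  have fK: "finite K"
    using assms(1) finite_subset by blast
  have "card (D - K) = d + 1 - card K"
    using assms(1) fK by (simp add: card_Diff_subset)
  then obtain R where R: "R \<subseteq> D - K" "card R = k - card K"
    using obtain_subset_with_card_n[of "k - card K" "D - K"] k_le_d by (metis diff_le_mono le_SucI Suc_eq_plus1)
  have fR: "finite R"
    using R(1) by (rule finite_subset) simp
  have cT: "card (D - K - R) = d + 1 - k"
    using R fK fR assms \<open>card (D - K) = _\<close> by (simp add: card_Diff_subset)
  let ?A1 = "A \<union> helper_vars (D - K - R) R"
  have "H ?A1 \<le> H A + real (card (D - K - R) * card R) * \<beta>"
    by (rule add_helpers) (use fR in auto)
  moreover have "H (?A1 \<union> node_vars R) \<le> H ?A1 + real (card R choose 2) * \<beta>"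
    by (rule repair_nodes[of R K]) (use R fR assms in auto)
  moreover have "B \<le> H (?A1 \<union> node_vars R)"
  proof (rule recovery[of "K \<union> R"])
    have "card (K \<union> R) = card K + card R"
      using R fK fR by (intro card_Un_disjoint) auto
    then show "card (K \<union> R) = k"
      using R assms by simp
  qed (use R assms in \<open>auto simp: node_vars_Un\<close>)
  ultimately show ?thesis
    unfolding cT R(2) of_nat_mult completion_cost_def by linarith
qed

text \<open>The classical cut-set bound, obtained by completing \<open>a\<close> nodes of entropy at
  most \<open>\<alpha>\<close> each; it supplies the term for \<open>q\<close>.\<close>

lemma functional_repair_bound:
  assumes "a \<le> k"
  shows "B \<le> Bq k d \<alpha> \<beta> a"
proof -
  have "B \<le> H (node_vars {1..a}) + completion_cost (card {1..a})"
    by (rule completion) (use assms k_le_d in auto)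
  then show ?thesis
    using nodes_le[of "{1..a}"] by (simp add: Bq_eq)
qed

text \<open>Splits off the first \<open>c\<close> repaired nodes: they exchange messages among
  themselves and receive one from each of the \<open>d + 1 - c - a\<close> nodes that are neither
  known nor among them.\<close>

lemma completion_cost_add:
  assumes "a + c \<le> k"
  shows "completion_cost a = completion_cost (a + c) + real (c choose 2) * \<beta>
           + real c * (real (d + 1 - c) - real a) * \<beta>"
proof -
  obtain x where x: "k = a + c + x"
    using assms le_Suc_ex by blast
  obtain y where y: "d = k + y"
    using k_le_d le_Suc_ex by blast
  show ?thesis
    using choose_two_add[of x c] unfolding completion_cost_def
    by (simp add: x y algebra_simps)
qed

text \<open>Repairing \<open>P\<close> from \<open>L \<union> T\<close> and repairing \<open>L\<close> from \<open>P \<union> T\<close> both produce all nodes of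
  \<open>L \<union> P\<close>; submodularity therefore returns the entropy of these nodes a second time, which is
  where the saving comes from.\<close>

lemma two_block_bound:
  assumes "L \<union> P \<union> T = D" "L \<inter> P = {}" "L \<inter> T = {}" "P \<inter> T = {}"
  shows "H (helper_vars T (L \<union> P) \<union> node_vars (L \<union> P)) + H (node_vars (L \<union> P))
     \<le> real (card L + card P) * \<alpha> + real (card L + card P) * real (card T) * \<beta>
        + real ((card L choose 2) + (card P choose 2)) * \<beta>"
proof -
  have fin: "finite L" "finite P" "finite T"
    using assms(1) by (metis finite_Un finite_atLeastAtMost)+
  have block: "H (node_vars X \<union> helper_vars T Y \<union> node_vars Y)
      \<le> real (card X) * \<alpha> + real (card T * card Y) * \<beta> + real (card Y choose 2) * \<beta>"
    \<comment> \<open>Used for both orders of the two blocks: \<open>X\<close> is stored,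
      \<open>Y\<close> is repaired from \<open>X\<close> and \<open>T\<close>.\<close>
    if "X \<union> Y = L \<union> P" "X \<inter> Y = {}" for X Y
  proof -
    have XY: "finite X" "finite Y"
      using that(1) fin by (metis finite_Un)+
    have "D - X - Y = T"
      using that assms by blast
    moreover have "X \<subseteq> D" "Y \<subseteq> D"
      using that assms by blast+
    ultimately have "H (node_vars X \<union> helper_vars T Y \<union> node_vars Y)
        \<le> H (node_vars X \<union> helper_vars T Y) + real (card Y choose 2) * \<beta>"
      using XY that by (intro repair_nodes[of Y X]) auto
    then show ?thesis
      using add_helpers[OF fin(3) XY(2), of "node_vars X"] nodes_le[OF XY(1)] by simp
  qed
  have "H (helper_vars T (L \<union> P) \<union> node_vars (L \<union> P)) + H (node_vars (L \<union> P))
      \<le> H (node_vars L \<union> helper_vars T P \<union> node_vars P)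
        + H (node_vars P \<union> helper_vars T L \<union> node_vars L)"
    by (rule submodular_le) (auto simp: node_vars_Un helper_vars_def)
  then show ?thesis
    using block[of L P] block[of P L] assms(2) by (simp add: algebra_simps Int_commute Un_commute)
qed

section \<open>Families with empty intersection\<close>

text \<open>Each summand beats its termwise estimate by \<open>g T - g (V i)\<close>, where
  \<open>g\<close> is the slack in counting messages at \<open>\<beta>\<close> each. Supermodularity
  and the empty intersection leave a total gain of one full \<open>g T\<close>.\<close>

lemma sum_nodes_and_helpers_bound:
  fixes V :: "nat \<Rightarrow> nat set"
  assumes "finite T" "finite C" and V: "\<And>i. i \<in> {1..Suc r} \<Longrightarrow> V i \<subseteq> T"
    and Inter: "(\<Inter>i\<in>{1..Suc r}. V i) = {}"
  shows "(\<Sum>i=1..Suc r. H (node_vars (V i) \<union> helper_vars T C))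
     \<le> (\<Sum>i=1..Suc r. real (card (V i)) * \<alpha> + real (card C) * (real (card T) - real (card (V i))) * \<beta>)
        + H (helper_vars T C) - real (card C) * real (card T) * \<beta>"
proof -
  define f where "f J = H (helper_vars J C)" for J
  define g where "g J = real (card C) * real (card J) * \<beta> - f J" for J
  have fin: "finite J" if "J \<subseteq> T" for J
    using that assms(1) finite_subset by blast
  have super: "g X + g Y \<le> g (X \<union> Y) + g (X \<inter> Y)" if "X \<subseteq> T" "Y \<subseteq> T" for X Y
  proof -
    have "f (X \<union> Y) + f (X \<inter> Y) \<le> f X + f Y"
      unfolding f_def by (rule submodular_le) (auto simp: helper_vars_def)
    moreover have "real (card X) + real (card Y) = real (card (X \<union> Y)) + real (card (X \<inter> Y))"
      using card_Un_Int[OF fin[OF that(1)] fin[OF that(2)]] by (metis of_nat_add)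
    then have "real (card C) * \<beta> * (real (card X) + real (card Y))
        = real (card C) * \<beta> * (real (card (X \<union> Y)) + real (card (X \<inter> Y)))"
      by simp
    ultimately show ?thesis
      by (simp add: g_def algebra_simps)
  qed
  have mono_g: "g X \<le> g T" if "X \<subseteq> T" for X
  proof -
    have "helper_vars X C \<union> helper_vars (T - X) C = helper_vars T C"
      using that by (auto simp: helper_vars_def)
    then have "f T \<le> f X + real (card (T - X) * card C) * \<beta>"
      using add_helpers[of "T - X" C "helper_vars X C"] assms by (simp add: f_def)
    moreover have "real (card (T - X)) = real (card T) - real (card X)"
      using that fin[OF that] assms(1) by (simp add: card_Diff_subset card_mono of_nat_diff)
    ultimately show ?thesis
      by (simp add: g_def algebra_simps)
  qed
  have "g {} = 0"
    by (simp add: g_def f_def helper_vars_def empty)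
  then have G: "(\<Sum>i=1..Suc r. g (V i)) \<le> real r * g T"
    using supermodular_Inter_bound[of T g r V] super mono_g V Inter by simp
  have "H (node_vars (V i) \<union> helper_vars T C)
      \<le> (real (card (V i)) * \<alpha> + real (card C) * (real (card T) - real (card (V i))) * \<beta>) + g (V i) - g T"
    if "i \<in> {1..Suc r}" for i
  proof -
    have Vi: "V i \<subseteq> T" "finite (V i)"
      using V[OF that] fin by auto
    \<comment> \<open>Both sets on the right contain the messages from \<open>V i\<close> to
      \<open>C\<close>, which the nodes in \<open>V i\<close> determine.\<close>
    have "H (node_vars (V i) \<union> helper_vars T C) + f (V i)
        \<le> H (node_vars (V i) \<union> helper_vars (V i) C) + f T"
      unfolding f_def by (rule submodular_le) (use Vi in \<open>auto simp: helper_vars_def\<close>)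
    moreover have "H (node_vars (V i) \<union> helper_vars (V i) C) = H (node_vars (V i))"
      by (rule nodes_determine_helpers) (use Vi assms in auto)
    ultimately show ?thesis
      using nodes_le[OF Vi(2)] by (simp add: g_def algebra_simps)
  qed
  then have "(\<Sum>i=1..Suc r. H (node_vars (V i) \<union> helper_vars T C))
     \<le> (\<Sum>i=1..Suc r. (real (card (V i)) * \<alpha> + real (card C) * (real (card T) - real (card (V i))) * \<beta>) + g (V i) - g T)"
    by (rule sum_mono)
  also have "\<dots> = (\<Sum>i=1..Suc r. real (card (V i)) * \<alpha> + real (card C) * (real (card T) - real (card (V i))) * \<beta>)
      + (\<Sum>i=1..Suc r. g (V i)) - real (Suc r) * g T"
    by (simp only: sum.distrib sum_subtractf) simp
  also have "\<dots> \<le> (\<Sum>i=1..Suc r. real (card (V i)) * \<alpha> + real (card C) * (real (card T) - real (card (V i))) * \<beta>) - g T"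
    using G by (simp add: algebra_simps)
  finally show ?thesis
    by (simp add: g_def f_def)
qed

text \<open>Of the \<open>r + 2\<close> copies of \<open>B\<close>, one comes from each
  \<open>V i\<close> and the last from completing \<open>C\<close> alone.\<close>

theorem empty_intersection_bound:
  fixes V :: "nat \<Rightarrow> nat set"
  assumes "l + m \<le> k"
    and V: "\<And>i. i \<in> {1..Suc r} \<Longrightarrow> V i \<subseteq> {l+m+1..d+1}"
      "\<And>i. i \<in> {1..Suc r} \<Longrightarrow> card (V i) \<le> k - l - m"
    and Inter: "(\<Inter>i\<in>{1..Suc r}. V i) = {}"
  shows "real (r + 2) * B \<le> (\<Sum>i=1..Suc r. Bq k d \<alpha> \<beta> (card (V i)))
           + Bq k d \<alpha> \<beta> (l + m) - real l * real m * \<beta>"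
proof -
  define L P C T where defs: "L = {1..l}" "P = {l+1..l+m}" "C = {1..l+m}" "T = {l+m+1..d+1}"
  define c where "c = l + m"
  define Z where "Z = helper_vars T C"
  define A where "A i = node_vars (V i) \<union> Z" for i
  \<comment> \<open>The conditional entropy of the nodes in \<open>C\<close> given \<open>Z\<close>;
    it bounds their cost on top of any \<open>A i\<close>, since \<open>A i\<close> contains
    \<open>Z\<close>.\<close>
  define h where "h = H (Z \<union> node_vars C) - H Z"
  have cards: "card L = l" "card P = m" "card C = c" "card T = d + 1 - c"
    by (auto simp: defs c_def)
  have CLP: "C = L \<union> P" and CT: "C \<inter> T = {}" "C \<union> T = D"
    using assms(1) k_le_d by (auto simp: defs)
  have fin: "finite C" "finite T"
    by (auto simp: defs)
  have two: "H (Z \<union> node_vars C) + H (node_vars C)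
      \<le> real c * \<alpha> + real c * real (d + 1 - c) * \<beta> + real ((l choose 2) + (m choose 2)) * \<beta>"
    using two_block_bound[of L P T] CT unfolding Z_def CLP cards c_def by (auto simp: defs cards)
  have DC: "D - {} - C = T"
    using CT by auto
  have h: "h \<le> real (c choose 2) * \<beta>"
  proof -
    have "H (Z \<union> node_vars C) \<le> H Z + real (card C choose 2) * \<beta>"
      by (rule repair_nodes[where K = "{}"])
        (use CT fin DC in \<open>auto simp: Z_def node_vars_def\<close>)
    then show ?thesis by (simp add: h_def cards)
  qed
  have each: "B \<le> H (A i) + h + completion_cost (card (V i) + c)" if i: "i \<in> {1..Suc r}" for i
  proof -
    have Vi: "finite (V i)" "V i \<inter> C = {}"
      using V(1)[OF i] CT fin by (auto simp: defs intro: finite_subset)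
    have "card (V i \<union> C) = card (V i) + c"
      using Vi fin by (simp add: card_Un_disjoint cards)
    moreover have "card (V i) + c \<le> k"
      using V(2)[OF i] assms(1) by (simp add: c_def)
    moreover have "V i \<union> C \<subseteq> D"
      using V(1)[OF i] CT by (auto simp: defs)
    ultimately have "B \<le> H (A i \<union> node_vars C) + completion_cost (card (V i) + c)"
      using completion[of "V i \<union> C" "A i \<union> node_vars C"] by (auto simp: A_def node_vars_Un)
    moreover have "H (A i \<union> node_vars C) + H Z \<le> H (A i) + H (Z \<union> node_vars C)"
      by (rule submodular_le) (auto simp: A_def)
    ultimately show ?thesis by (simp add: h_def)
  qed
  have cost: "completion_cost (card (V i)) = completion_cost (card (V i) + c) + real (c choose 2) * \<beta>
      + real c * (real (d + 1 - c) - real (card (V i))) * \<beta>" if "i \<in> {1..Suc r}" for i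
    using V(2)[OF that] assms(1) by (intro completion_cost_add) (simp add: c_def)
  have "real (Suc r) * B = (\<Sum>i=1..Suc r. B)"
    by simp
  also have "\<dots> \<le> (\<Sum>i=1..Suc r. H (A i) + h + completion_cost (card (V i) + c))"
    by (rule sum_mono) (rule each)
  also have "\<dots> = (\<Sum>i=1..Suc r. H (A i)) + (\<Sum>i=1..Suc r. completion_cost (card (V i) + c)) + real (Suc r) * h"
    by (simp only: sum.distrib) simp
  finally have 1: "real (Suc r) * B \<le> (\<Sum>i=1..Suc r. H (A i))
      + (\<Sum>i=1..Suc r. completion_cost (card (V i) + c)) + real (Suc r) * h" .
  have 2: "(\<Sum>i=1..Suc r. H (A i))
      \<le> (\<Sum>i=1..Suc r. real (card (V i)) * \<alpha> + real c * (real (d + 1 - c) - real (card (V i))) * \<beta>)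
        + H Z - real c * real (d + 1 - c) * \<beta>"
    using sum_nodes_and_helpers_bound[OF fin(2) fin(1), of r V] V(1) Inter
    unfolding A_def Z_def cards by (simp add: defs)
  have "(\<Sum>i=1..Suc r. Bq k d \<alpha> \<beta> (card (V i)))
      = (\<Sum>i=1..Suc r. (real (card (V i)) * \<alpha> + real c * (real (d + 1 - c) - real (card (V i))) * \<beta>)
          + completion_cost (card (V i) + c) + real (c choose 2) * \<beta>)"
    by (rule sum.cong) (use cost in \<open>auto simp: Bq_eq\<close>)
  also have "\<dots> = (\<Sum>i=1..Suc r. real (card (V i)) * \<alpha> + real c * (real (d + 1 - c) - real (card (V i))) * \<beta>)
      + (\<Sum>i=1..Suc r. completion_cost (card (V i) + c)) + real (Suc r) * (real (c choose 2) * \<beta>)"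
    by (simp only: sum.distrib) simp
  finally have 3: "(\<Sum>i=1..Suc r. Bq k d \<alpha> \<beta> (card (V i))) = \<dots>" .
  have 4: "B \<le> H (node_vars C) + completion_cost c"
    using completion[of C "node_vars C"] CT assms(1) by (auto simp: cards c_def)
  \<comment> \<open>Only \<open>r\<close> of the \<open>Suc r\<close> copies of \<open>h\<close> are
    estimated. The last one joins \<open>H Z\<close> from \<open>2\<close> to form
    \<open>H (Z \<union> node_vars C)\<close>, and with \<open>H (node_vars C)\<close> from
    \<open>4\<close> this is the left side of \<open>two\<close>.\<close>
  have 5: "real r * h \<le> real r * (real (c choose 2) * \<beta>)"
    using h by (intro mult_left_mono) auto
  have 6: "real (c choose 2) * \<beta> = real ((l choose 2) + (m choose 2)) * \<beta> + real l * real m * \<beta>"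
    using choose_two_add[of l m] by (simp add: c_def algebra_simps)
  have 7: "Bq k d \<alpha> \<beta> (l + m) = real c * \<alpha> + completion_cost c"
    by (simp add: Bq_eq c_def)
  have e1: "real (Suc r) * h = real r * h + h" 
    "real (Suc r) * (real (c choose 2) * \<beta>) = real r * (real (c choose 2) * \<beta>) + real (c choose 2) * \<beta>"
    "real (r + 2) * B = real (Suc r) * B + B"
    by (simp_all add: algebra_simps)
  show ?thesis
    using 1 2 3 4 5 6 7 two e1 h_def by linarith
qed

end

section \<open>The entropy polymatroid of an exact-repair code\<close>

lemma determines_trans: "determines p X Y \<Longrightarrow> determines p Y Z \<Longrightarrow> determines p X Z"
  unfolding determines_def by blast

text \<open>The sum type gives stored data and messages a common alphabet, so that any mixture of
  them is one function-valued variable.\<close>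

definition code_var :: "(nat \<Rightarrow> 'w \<Rightarrow> 'a) \<Rightarrow> (nat \<Rightarrow> nat \<Rightarrow> 'w \<Rightarrow> 'b) \<Rightarrow> nat + nat \<times> nat \<Rightarrow> 'w \<Rightarrow> 'a + 'b" where
  "code_var W S v \<omega> = (case v of Inl j \<Rightarrow> Inl (W j \<omega>) | Inr (i, j) \<Rightarrow> Inr (S i j \<omega>))"

definition code_index :: "nat \<Rightarrow> (nat + nat \<times> nat) set" where
  "code_index n = Inl ` {1..n} \<union> Inr ` {(i, j). i \<in> {1..n} \<and> j \<in> {1..n} \<and> i \<noteq> j}"

text \<open>Indices that do not belong to the code are ignored, so that they carry no entropy and the
  polymatroid axioms hold for all sets of indices.\<close>

definition joint_var :: "(nat \<Rightarrow> 'w \<Rightarrow> 'a) \<Rightarrow> (nat \<Rightarrow> nat \<Rightarrow> 'w \<Rightarrow> 'b) \<Rightarrow> nat \<Rightarrow> (nat + nat \<times> nat) set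
    \<Rightarrow> 'w \<Rightarrow> nat + nat \<times> nat \<Rightarrow> 'a + 'b" where
  "joint_var W S n A \<omega> = restrict (\<lambda>v. code_var W S v \<omega>) (A \<inter> code_index n)"

lemma joint_var_eq_iff:
  "joint_var W S n A \<omega> = joint_var W S n A \<omega>'
     \<longleftrightarrow> (\<forall>v\<in>A \<inter> code_index n. code_var W S v \<omega> = code_var W S v \<omega>')"
  unfolding joint_var_def restrict_def fun_eq_iff by metis

lemma determines_joint_varI:
  assumes "\<And>v. v \<in> A \<inter> code_index n \<Longrightarrow> determines p Y (code_var W S v)"
  shows "determines p Y (joint_var W S n A)"
  using assms unfolding determines_def joint_var_eq_iff by blast

lemma joint_var_determines:
  assumes "v \<in> A \<inter> code_index n"
  shows "determines p (joint_var W S n A) (code_var W S v)"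
  using assms unfolding determines_def joint_var_eq_iff by blast

lemma joint_var_determines_mono:
  "A \<subseteq> C \<Longrightarrow> determines p (joint_var W S n C) (joint_var W S n A)"
  unfolding determines_def joint_var_eq_iff by blast

lemma joint_var_determines_insert:
  assumes "v \<in> code_index n \<Longrightarrow> determines p (joint_var W S n A) (code_var W S v)"
  shows "determines p (joint_var W S n A) (joint_var W S n (insert v A))"
  by (rule determines_joint_varI) (use assms in \<open>auto intro: joint_var_determines\<close>)

lemma determines_code_var:
  "determines p Y (code_var W S (Inl j)) \<longleftrightarrow> determines p Y (W j)"
  "determines p Y (code_var W S (Inr (i, j))) \<longleftrightarrow> determines p Y (S i j)"
  by (simp_all add: determines_def code_var_def)

lemma shannon_joint_var_singleton:
  assumes ent: "v \<in> code_index n \<Longrightarrow> ent p Y = ennreal b" and b: "b \<ge> 0"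
    and det: "determines p Y (code_var W S v)"
  shows "shannon p (joint_var W S n {v}) \<le> b"
proof (cases "v \<in> code_index n")
  case True
  have "determines p Y (joint_var W S n {v})"
    by (rule determines_joint_varI) (use det in auto)
  then show ?thesis
    using shannon_mono[of p Y "joint_var W S n {v}"] ent_finite_imp[OF ent[OF True] b] by simp
next
  case False
  then have "joint_var W S n {v} = (\<lambda>\<omega>. \<lambda>u. undefined)"
    by (auto simp: joint_var_def restrict_def fun_eq_iff)
  then show ?thesis
    using b by (simp add: shannon_const)
qed

text \<open>Every code variable is a function of \<open>M\<close> on the support, and
  \<open>M\<close> has finite entropy; this makes all surprisals integrable and the entropy
  inequalities applicable.\<close>

lemma repair_polymatroid_of_code:
  fixes W :: "nat \<Rightarrow> 'w \<Rightarrow> 'a" and S :: "nat \<Rightarrow> nat \<Rightarrow> 'w \<Rightarrow> 'b"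
  assumes code: "exact_repair_code p n k d B \<alpha> \<beta> M W S" and "k \<le> d" "d + 1 \<le> n"
  shows "repair_polymatroid (\<lambda>A. shannon p (joint_var W S n A)) k d B \<alpha> \<beta>"
proof -
  let ?X = "joint_var W S n"
  have nonneg: "B \<ge> 0" "\<alpha> \<ge> 0" "\<beta> \<ge> 0" and entM: "ent p M = ennreal B"
    using code by (auto simp: exact_repair_code_def)
  have entW: "ent p (W j) = ennreal \<alpha>" and MW: "determines p M (W j)" if "j \<in> {1..n}" for j
    using code that by (auto simp: exact_repair_code_def intro: cent_0_imp_determines)
  have WM: "determines p (Wset W J) M" if "J \<subseteq> {1..n}" "card J \<ge> k" for J
    using code that by (auto simp: exact_repair_code_def intro: cent_0_imp_determines)
  have entS: "ent p (S i j) = ennreal \<beta>" and WS: "determines p (W i) (S i j)"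
    if "i \<in> {1..n}" "j \<in> {1..n}" "i \<noteq> j" for i j
    using code that by (auto simp: exact_repair_code_def intro: cent_0_imp_determines)
  have SW: "determines p (Sset S I {j}) (W j)" if "j \<in> {1..n}" "I \<subseteq> {1..n} - {j}" "card I \<ge> d" for I j
    using code that by (auto simp: exact_repair_code_def intro: cent_0_imp_determines)
  have M_all: "determines p M (code_var W S v)" if "v \<in> code_index n" for v
    using that MW determines_trans[OF MW WS] by (auto simp: code_index_def determines_code_var)
  note intM = integrable_surprisal_of_ent[OF entM nonneg(1)]
  have M_joint: "determines p M (?X A)" for A
    by (rule determines_joint_varI) (use M_all in auto)
  have int: "integrable (measure_pmf p) (surprisal p (?X A))" for A
    by (rule integrable_surprisal_determined[OF M_joint intM])
  show ?thesis
  proof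
    fix A C :: "(nat + nat \<times> nat) set"
    show "shannon p (?X A) \<le> shannon p (?X C)" if "A \<subseteq> C"
      by (rule shannon_mono[OF joint_var_determines_mono[OF that] int])
    \<comment> \<open>Conditioning on the variables indexed by \<open>A \<inter> C\<close> turns the
      inequality for triples into set submodularity; the repeated components add no entropy.\<close>
    let ?T = "\<lambda>\<omega>. (?X A \<omega>, ?X C \<omega>, ?X (A \<inter> C) \<omega>)"
    have "determines p M ?T"
      using M_joint[of A] M_joint[of C] M_joint[of "A \<inter> C"] unfolding determines_def by blast
    then have intT: "integrable (measure_pmf p) (surprisal p ?T)"
      by (rule integrable_surprisal_determined[OF _ intM])
    have "determines p ?T (?X (A \<union> C))"
      unfolding determines_def prod.inject joint_var_eq_iff by blast
    then have "shannon p (?X (A \<union> C)) \<le> shannon p ?T"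
      by (rule shannon_mono[OF _ intT])
    moreover have pair: "shannon p (\<lambda>\<omega>. (?X E \<omega>, ?X (A \<inter> C) \<omega>)) \<le> shannon p (?X E)" if "A \<inter> C \<subseteq> E" for E
    proof (rule shannon_mono[OF _ int])
      show "determines p (?X E) (\<lambda>\<omega>. (?X E \<omega>, ?X (A \<inter> C) \<omega>))"
        using joint_var_determines_mono[OF that, of p W S n] unfolding determines_def by blast
    qed
    ultimately show "shannon p (?X (A \<union> C)) + shannon p (?X (A \<inter> C)) \<le> shannon p (?X A) + shannon p (?X C)"
      using shannon_submodular[OF intT] pair[OF inf_le1] pair[OF inf_le2] by linarith
  next
    have "?X {} = (\<lambda>\<omega>. \<lambda>u. undefined)"
      by (simp add: joint_var_def restrict_def fun_eq_iff)
    then show "shannon p (?X {}) = 0"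
      by (simp add: shannon_const)
  next
    fix i j
    show "shannon p (?X {Inl j}) \<le> \<alpha>"
      by (rule shannon_joint_var_singleton[of _ _ _ "W j"])
        (use entW nonneg in \<open>auto simp: code_index_def code_var_def determines_def\<close>)
    show "shannon p (?X {Inr (i, j)}) \<le> \<beta>"
      by (rule shannon_joint_var_singleton[of _ _ _ "S i j"])
        (use entS nonneg in \<open>auto simp: code_index_def code_var_def determines_def\<close>)
    show "shannon p (?X (insert (Inr (i, j)) A)) \<le> shannon p (?X A)" if "Inl i \<in> A" for A
    proof (rule shannon_mono[OF joint_var_determines_insert int])
      assume "Inr (i, j) \<in> code_index n"
      then have ij: "i \<in> {1..n}" "j \<in> {1..n}" "i \<noteq> j"
        by (auto simp: code_index_def)
      have "determines p (?X A) (code_var W S (Inl i))"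
        by (rule joint_var_determines) (use that ij in \<open>auto simp: code_index_def\<close>)
      then show "determines p (?X A) (code_var W S (Inr (i, j)))"
        unfolding determines_code_var using WS[OF ij] by (rule determines_trans)
    qed
  next
    fix j A assume j: "j \<in> {1..d+1}" and A: "helper_vars ({1..d+1} - {j}) {j} \<subseteq> A"
    show "shannon p (?X (insert (Inl j) A)) \<le> shannon p (?X A)"
    proof (rule shannon_mono[OF joint_var_determines_insert int])
      let ?I = "{1..d+1} - {j}"
      have *: "S i j \<omega> = S i j \<omega>'" if "i \<in> ?I" "?X A \<omega> = ?X A \<omega>'" for i \<omega> \<omega>'
      proof -
        have "Inr (i, j) \<in> A \<inter> code_index n"
          using A that(1) j \<open>d + 1 \<le> n\<close> by (auto simp: helper_vars_def code_index_def)
        from that(2)[unfolded joint_var_eq_iff, rule_format, OF this] show ?thesis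
          by (simp add: code_var_def)
      qed
      have "determines p (?X A) (Sset S ?I {j})"
        unfolding determines_def
      proof (intro ballI impI)
        fix \<omega> \<omega>' assume "?X A \<omega> = ?X A \<omega>'"
        note *[OF _ this]
        then show "Sset S ?I {j} \<omega> = Sset S ?I {j} \<omega>'"
          by (auto simp: Sset_def fun_eq_iff)
      qed
      moreover have "determines p (Sset S ?I {j}) (W j)"
        by (rule SW) (use j \<open>d + 1 \<le> n\<close> in auto)
      ultimately show "determines p (?X A) (code_var W S (Inl j))"
        unfolding determines_code_var by (rule determines_trans)
    qed
  next
    fix J A assume J: "J \<subseteq> {1..d+1}" "card J = k" and A: "node_vars J \<subseteq> A"
    have *: "W j \<omega> = W j \<omega>'" if "j \<in> J" "?X A \<omega> = ?X A \<omega>'" for j \<omega> \<omega>'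
    proof -
      have "Inl j \<in> A \<inter> code_index n"
        using A that(1) J(1) \<open>d + 1 \<le> n\<close> by (auto simp: node_vars_def code_index_def)
      from that(2)[unfolded joint_var_eq_iff, rule_format, OF this] show ?thesis
        by (simp add: code_var_def)
    qed
    have "determines p (?X A) (Wset W J)"
      unfolding determines_def
    proof (intro ballI impI)
      fix \<omega> \<omega>' assume "?X A \<omega> = ?X A \<omega>'"
      note *[OF _ this]
      then show "Wset W J \<omega> = Wset W J \<omega>'"
        by (auto simp: Wset_def restrict_def fun_eq_iff)
    qed
    moreover have "determines p (Wset W J) M"
      by (rule WM) (use J \<open>d + 1 \<le> n\<close> in auto)
    ultimately have "determines p (?X A) M"
      by (rule determines_trans)
    from shannon_mono[OF this int] show "B \<le> shannon p (?X A)"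
      by (simp add: shannon_of_ent[OF entM nonneg(1)])
  qed (use assms nonneg in auto)
qed

theorem mainTheorem1:
  fixes p :: "'w pmf" and M :: "'w \<Rightarrow> 'm" and W :: "nat \<Rightarrow> 'w \<Rightarrow> 'a"
    and S :: "nat \<Rightarrow> nat \<Rightarrow> 'w \<Rightarrow> 'b"
    and n k d q l m N :: nat and B \<alpha> \<beta> :: real and V :: "nat \<Rightarrow> nat set"
  assumes "1 \<le> k" and "k \<le> d" and "d \<le> n - 1"
    and "exact_repair_code p n k d B \<alpha> \<beta> M W S"
    and "0 < q" and "0 < l" and "0 < m" and "q + l + m \<le> k"
    and "N \<ge> 3"
    and "\<forall>i\<in>{1..N-2}. V i \<subseteq> {l+m+1..d+1} \<and> card (V i) \<le> k - l - m"
    and "(\<Inter>i\<in>{1..N-2}. V i) = {}"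
  shows "real N * B \<le> Bq k d \<alpha> \<beta> q + (\<Sum>i=1..N-2. Bq k d \<alpha> \<beta> (card (V i)))
           + Bq k d \<alpha> \<beta> (l + m) - real l * real m * \<beta>"
proof -
  interpret repair_polymatroid "\<lambda>A. shannon p (joint_var W S n A)" k d B \<alpha> \<beta>
    by (rule repair_polymatroid_of_code) (use assms in auto)
  \<comment> \<open>With \<open>N - 2 = r + 1\<close> sets, the intersection bound accounts for
    \<open>N - 1\<close> copies of \<open>B\<close>; the remaining copy is bounded by
    \<open>Bq\<close> at \<open>q\<close>.\<close>
  define r where "r = N - 3"
  have r: "N - 2 = Suc r" "real N = real (r + 2) + 1"
    using \<open>N \<ge> 3\<close> by (auto simp: r_def)
  have "real (r + 2) * B \<le> (\<Sum>i=1..N-2. Bq k d \<alpha> \<beta> (card (V i)))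
      + Bq k d \<alpha> \<beta> (l + m) - real l * real m * \<beta>"
    using empty_intersection_bound[of l m r V] assms unfolding r(1) by auto
  moreover have "B \<le> Bq k d \<alpha> \<beta> q"
    by (rule functional_repair_bound) (use assms in auto)
  ultimately show ?thesis
    unfolding r(2) by (simp add: algebra_simps)
qed

end
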